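(* For any positive integer $m$ there exist a positive integer $n$ and a minimal non-basic subset $M\subset[n]^3$ whose irreducible annihilation function $f$ has the value $f(x)=m$ for some $x\in M$.
   Context: Notation: $[n]=\{1,\ldots,n\}$. A subset $M\subset[n]^3$ is called basic if for any function $f\colon M\to\mathbb{R}$ there exist functions $f_1,f_2,f_3\colon\mathbb{R}\to\mathbb{R}$ such that $f(x_1,x_2,x_3)=f_1(x_1)+f_2(x_2)+f_3(x_3)$ for every $(x_1,x_2,x_3)\in M$; otherwise it is non-basic. A non-basic subset $M\subset[n]^3$ is called minimal if every proper subset $K\subsetneq M$ is basic. A layer of $[n]^3$ is a plane given by an equation $x_i=j$ with $i\in\{1,2,3\}$, $j\in[n]$. An annihilation function of $M$ is a function $f\colon M\to\mathbb{Z}$ such that $\sum_{x\in L\cap M} f(x)=0$ for each layer $L$. For a minimal non-basic $M$, non-trivial annihilation functions are unique up to multiplication by a constant; an annihilation function of a minimal non-basic $M$ is called irreducible if its values are setwise coprime integers (their greatest common divisor is $1$). The irreducible annihilation function is thus determined up to sign. *)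

theory Defs
  imports Complex_Main
begin

definition cube :: "nat \<Rightarrow> (nat \<times> nat \<times> nat) set" where
  "cube n = {1..n} \<times> {1..n} \<times> {1..n}"

text \<open>A function on \<open>M\<close> is represented by a total function whose values outside \<open>M\<close> are
  never consulted.\<close>

definition basic :: "(nat \<times> nat \<times> nat) set \<Rightarrow> bool" where
  "basic M \<longleftrightarrow> (\<forall>f :: nat \<times> nat \<times> nat \<Rightarrow> real. \<exists>f1 f2 f3 :: real \<Rightarrow> real.
     \<forall>(x1, x2, x3) \<in> M. f (x1, x2, x3) = f1 (real x1) + f2 (real x2) + f3 (real x3))"

definition minimal_non_basic :: "(nat \<times> nat \<times> nat) set \<Rightarrow> bool" where
  "minimal_non_basic M \<longleftrightarrow> \<not> basic M \<and> (\<forall>K. K \<subset> M \<longrightarrow> basic K)"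

definition layers :: "nat \<Rightarrow> (nat \<times> nat \<times> nat) set set" where
  "layers n = {{(x1, x2, x3) \<in> cube n. x1 = j} | j. j \<in> {1..n}}
            \<union> {{(x1, x2, x3) \<in> cube n. x2 = j} | j. j \<in> {1..n}}
            \<union> {{(x1, x2, x3) \<in> cube n. x3 = j} | j. j \<in> {1..n}}"

definition annihilation_function ::
  "nat \<Rightarrow> (nat \<times> nat \<times> nat) set \<Rightarrow> (nat \<times> nat \<times> nat \<Rightarrow> int) \<Rightarrow> bool" where
  "annihilation_function n M f \<longleftrightarrow> (\<forall>L \<in> layers n. (\<Sum>x \<in> L \<inter> M. f x) = 0)"

text \<open>The \<open>Gcd\<close> condition excludes the zero function, as \<open>Gcd {0} = Gcd {} = 0\<close>.\<close>

definition irreducible_annihilation_function ::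
  "nat \<Rightarrow> (nat \<times> nat \<times> nat) set \<Rightarrow> (nat \<times> nat \<times> nat \<Rightarrow> int) \<Rightarrow> bool" where
  "irreducible_annihilation_function n M f \<longleftrightarrow>
     annihilation_function n M f \<and> Gcd (f ` M) = 1"

end

theory Submission
  imports Defs
begin

text \<open>
  A function of the form \<open>a x\<^sub>1 + b x\<^sub>2 + c x\<^sub>3\<close> is orthogonal on \<open>M\<close> to every annihilation
  function of \<open>M\<close> (\<open>annihilator_orthogonal\<close>). So a set with a nonzero annihilation function is
  not basic. If the annihilation function \<open>f\<close> vanishes nowhere on \<open>M\<close>, and \<open>M\<close> becomes basic when
  one particular point is removed, then it becomes basic when any point is removed: a missing
  value can be chosen to make the data orthogonal to \<open>f\<close>, and orthogonality then forces the
  decomposition to be correct at the particular point too (\<open>minimal_non_basicI\<close>). Hence one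
  nowhere vanishing annihilation function and one explicit system of decompositions suffice.

  The set is a star around \<open>(1, 1, 1)\<close>. That point gets the value \<open>m\<close>, and each of the three
  layers through it has \<open>m\<close> further points, of value \<open>-1\<close>. These points also lie on layers
  \<open>x\<^sub>k = j\<close> with \<open>2 \<le> j \<le> 2 * m + 1\<close>, and each such layer contains exactly one of them. It is
  balanced by the diagonal point \<open>(j, j, j)\<close>, of value \<open>1\<close>. In other words, the diagonal points
  are the vertices of a cubic graph on \<open>2 * m\<close> vertices whose edges are the points of value \<open>-1\<close>;
  an edge joins \<open>j\<close> and \<open>k\<close> when its coordinates are \<open>1\<close>, \<open>j\<close> and \<open>k\<close> in some order. The graph is
  chosen connected, namely as a cycle in which every second edge is doubled. Connectedness makes
  the annihilation function unique up to a factor. Concretely, once one edge of the cycle is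
  removed, the system for the decomposition is solved by running along the remaining path
  (\<open>basic_open_star\<close>).
\<close>

section \<open>Annihilation functions and minimal non-basic sets\<close>

lemma basic_iff:
  "basic M \<longleftrightarrow> (\<forall>g :: nat \<times> nat \<times> nat \<Rightarrow> real. \<exists>a b c :: nat \<Rightarrow> real.
     \<forall>(x, y, z) \<in> M. g (x, y, z) = a x + b y + c z)"
proof
  assume M: "basic M"
  show "\<forall>g :: nat \<times> nat \<times> nat \<Rightarrow> real. \<exists>a b c :: nat \<Rightarrow> real.
     \<forall>(x, y, z) \<in> M. g (x, y, z) = a x + b y + c z"
  proof
    fix g :: "nat \<times> nat \<times> nat \<Rightarrow> real"
    obtain f1 f2 f3 :: "real \<Rightarrow> real" where
      "\<forall>(x, y, z) \<in> M. g (x, y, z) = f1 (real x) + f2 (real y) + f3 (real z)"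
      using M unfolding basic_def by meson
    then show "\<exists>a b c :: nat \<Rightarrow> real. \<forall>(x, y, z) \<in> M. g (x, y, z) = a x + b y + c z"
      by (intro exI[of _ "\<lambda>n. f1 (real n)"] exI[of _ "\<lambda>n. f2 (real n)"]
          exI[of _ "\<lambda>n. f3 (real n)"])
  qed
next
  assume R: "\<forall>g :: nat \<times> nat \<times> nat \<Rightarrow> real. \<exists>a b c :: nat \<Rightarrow> real.
     \<forall>(x, y, z) \<in> M. g (x, y, z) = a x + b y + c z"
  show "basic M"
    unfolding basic_def
  proof
    fix g :: "nat \<times> nat \<times> nat \<Rightarrow> real"
    obtain a b c :: "nat \<Rightarrow> real" where
      "\<forall>(x, y, z) \<in> M. g (x, y, z) = a x + b y + c z"
      using R by meson
    then show "\<exists>f1 f2 f3 :: real \<Rightarrow> real.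
        \<forall>(x, y, z) \<in> M. g (x, y, z) = f1 (real x) + f2 (real y) + f3 (real z)"
      by (intro exI[of _ "\<lambda>r. a (nat \<lfloor>r\<rfloor>)"] exI[of _ "\<lambda>r. b (nat \<lfloor>r\<rfloor>)"]
          exI[of _ "\<lambda>r. c (nat \<lfloor>r\<rfloor>)"]) simp
  qed
qed

lemma basic_subset: "basic M \<Longrightarrow> K \<subseteq> M \<Longrightarrow> basic K"
  unfolding basic_iff by (meson subsetD)

lemma annihilation_function_iff:
  assumes "M \<subseteq> cube n"
  shows "annihilation_function n M f \<longleftrightarrow>
    (\<forall>j \<in> {1..n}. sum f {x \<in> M. fst x = j} = 0 \<and> sum f {x \<in> M. fst (snd x) = j} = 0 \<and>
       sum f {x \<in> M. snd (snd x) = j} = 0)"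
proof -
  have "{(x1, x2, x3) \<in> cube n. x1 = j} \<inter> M = {x \<in> M. fst x = j}"
    "{(x1, x2, x3) \<in> cube n. x2 = j} \<inter> M = {x \<in> M. fst (snd x) = j}"
    "{(x1, x2, x3) \<in> cube n. x3 = j} \<inter> M = {x \<in> M. snd (snd x) = j}" for j
    using assms by auto
  moreover have "annihilation_function n M f \<longleftrightarrow>
    (\<forall>j \<in> {1..n}. sum f ({(x1, x2, x3) \<in> cube n. x1 = j} \<inter> M) = 0 \<and>
       sum f ({(x1, x2, x3) \<in> cube n. x2 = j} \<inter> M) = 0 \<and>
       sum f ({(x1, x2, x3) \<in> cube n. x3 = j} \<inter> M) = 0)"
    unfolding annihilation_function_def layers_def by blast
  ultimately show ?thesis
    by simp
qed

lemma finite_cube: "finite (cube n)"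
  by (simp add: cube_def)

lemma weighted_sum_eq_0:
  fixes f :: "'a \<Rightarrow> int" and h :: "nat \<Rightarrow> real"
  assumes "finite M" and "p ` M \<subseteq> {1..n}" and "\<And>j. j \<in> {1..n} \<Longrightarrow> sum f {x \<in> M. p x = j} = 0"
  shows "(\<Sum>x\<in>M. of_int (f x) * h (p x)) = 0"
proof -
  have "(\<Sum>x\<in>M. of_int (f x) * h (p x))
      = (\<Sum>j\<in>{1..n}. \<Sum>x\<in>{x \<in> M. p x = j}. of_int (f x) * h (p x))"
    using assms by (intro sum.group[symmetric]) auto
  also have "\<dots> = (\<Sum>j\<in>{1..n}. of_int (sum f {x \<in> M. p x = j}) * h j)"
    by (intro sum.cong refl) (simp add: sum_distrib_right)
  also have "\<dots> = 0"
    using assms(3) by (intro sum.neutral) auto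
  finally show ?thesis .
qed

text \<open>Grouping the points by their \<open>k\<close>-th coordinate turns the part of the sum belonging to the
  \<open>k\<close>-th summand into a combination of layer sums of \<open>f\<close>.\<close>

lemma annihilator_orthogonal:
  fixes a b c :: "nat \<Rightarrow> real"
  assumes M: "M \<subseteq> cube n" and f: "annihilation_function n M f"
    and g: "\<And>x y z. (x, y, z) \<in> M \<Longrightarrow> g (x, y, z) = a x + b y + c z"
  shows "(\<Sum>x\<in>M. of_int (f x) * g x) = 0"
proof -
  have fin: "finite M"
    using M finite_cube finite_subset by blast
  have "(\<Sum>x\<in>M. of_int (f x) * a (fst x)) = 0"
    using M f annihilation_function_iff[OF M]
    by (intro weighted_sum_eq_0[where n = n] fin) (auto simp: cube_def)
  moreover have "(\<Sum>x\<in>M. of_int (f x) * b (fst (snd x))) = 0"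
    using M f annihilation_function_iff[OF M]
    by (intro weighted_sum_eq_0[where n = n and p = "\<lambda>x. fst (snd x)"] fin) (auto simp: cube_def)
  moreover have "(\<Sum>x\<in>M. of_int (f x) * c (snd (snd x))) = 0"
    using M f annihilation_function_iff[OF M]
    by (intro weighted_sum_eq_0[where n = n and p = "\<lambda>x. snd (snd x)"] fin) (auto simp: cube_def)
  moreover have "(\<Sum>x\<in>M. of_int (f x) * g x) = (\<Sum>x\<in>M. of_int (f x) * a (fst x)
      + of_int (f x) * b (fst (snd x)) + of_int (f x) * c (snd (snd x)))"
    using g by (intro sum.cong refl) (auto simp: distrib_left)
  ultimately show ?thesis
    by (simp add: sum.distrib)
qed

lemma not_basic_if_annihilator:
  assumes M: "M \<subseteq> cube n" and f: "annihilation_function n M f" and p: "p \<in> M" "f p \<noteq> 0"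
  shows "\<not> basic M"
proof
  assume "basic M"
  define g :: "nat \<times> nat \<times> nat \<Rightarrow> real" where "g = (\<lambda>x. if x = p then 1 else 0)"
  obtain a b c where "\<forall>(x, y, z) \<in> M. g (x, y, z) = a x + b y + c z"
    using \<open>basic M\<close> unfolding basic_iff by meson
  then have "(\<Sum>x\<in>M. of_int (f x) * g x) = 0"
    by (intro annihilator_orthogonal[OF M f, of g a b c]) auto
  moreover have "(\<Sum>x\<in>M. of_int (f x) * g x) = of_int (f p)"
    using p finite_subset[OF M finite_cube] by (simp add: g_def if_distrib cong: if_cong)
  ultimately show False
    using p by simp
qed

text \<open>This is the exchange property of a circuit: all coefficients of its linear dependency are
  nonzero, so the independence of the circuit without one element carries over to every other
  element.\<close>

lemma basic_remove_exchange:
  assumes M: "M \<subseteq> cube n" and f: "annihilation_function n M f"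
    and p: "p \<in> M" "f p \<noteq> 0" "basic (M - {p})"
    and q: "q \<in> M" "f q \<noteq> 0"
  shows "basic (M - {q})"
  unfolding basic_iff
proof
  fix g :: "nat \<times> nat \<times> nat \<Rightarrow> real"
  have fin: "finite M"
    using M finite_cube finite_subset by blast
  \<comment> \<open>The values of \<open>g\<close> on \<open>M - {q}\<close> determine the value at \<open>q\<close> that makes the data
    orthogonal to \<open>f\<close>.\<close>
  define g' where "g' = g(q := - (\<Sum>x\<in>M - {q}. of_int (f x) * g x) / of_int (f q))"
  have "(\<Sum>x\<in>M. of_int (f x) * g' x)
      = of_int (f q) * g' q + (\<Sum>x\<in>M - {q}. of_int (f x) * g' x)"
    using fin q by (simp add: sum.remove)
  also have "(\<Sum>x\<in>M - {q}. of_int (f x) * g' x) = (\<Sum>x\<in>M - {q}. of_int (f x) * g x)"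
    by (intro sum.cong) (auto simp: g'_def)
  finally have g': "(\<Sum>x\<in>M. of_int (f x) * g' x) = 0"
    using q by (simp add: g'_def)
  obtain a b c where abc: "\<forall>(x, y, z) \<in> M - {p}. g' (x, y, z) = a x + b y + c z"
    using p(3) unfolding basic_iff by meson
  define h where "h = (\<lambda>(x, y, z). a x + b y + c z)"
  have gh: "g' x = h x" if "x \<in> M - {p}" for x
    using bspec[OF abc that] by (cases x) (simp add: h_def)
  have "(\<Sum>x\<in>M. of_int (f x) * h x) = 0"
    by (intro annihilator_orthogonal[OF M f, of h a b c]) (simp add: h_def)
  moreover have "(\<Sum>x\<in>M - {p}. of_int (f x) * g' x) = (\<Sum>x\<in>M - {p}. of_int (f x) * h x)"
    using gh by (intro sum.cong) auto
  ultimately have "of_int (f p) * g' p = of_int (f p) * h p"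
    using g' sum.remove[OF fin p(1), of "\<lambda>x. of_int (f x) * g' x"]
      sum.remove[OF fin p(1), of "\<lambda>x. of_int (f x) * h x"] by linarith
  then have "g' x = h x" if "x \<in> M" for x
    using that gh p by (cases "x = p") auto
  then have "\<forall>(x, y, z) \<in> M - {q}. g (x, y, z) = a x + b y + c z"
    unfolding g'_def h_def by (fastforce split: if_splits)
  then show "\<exists>a b c. \<forall>(x, y, z) \<in> M - {q}. g (x, y, z) = a x + b y + c z"
    by blast
qed

lemma minimal_non_basicI:
  assumes M: "M \<subseteq> cube n" and f: "annihilation_function n M f"
    and nz: "\<And>x. x \<in> M \<Longrightarrow> f x \<noteq> 0"
    and p: "p \<in> M" "basic (M - {p})"
  shows "minimal_non_basic M"
  unfolding minimal_non_basic_def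
proof (intro conjI allI impI)
  show "\<not> basic M"
    using not_basic_if_annihilator[OF M f p(1)] nz p(1) by blast
next
  fix K
  assume "K \<subset> M"
  then obtain q where q: "q \<in> M" "K \<subseteq> M - {q}"
    by blast
  then show "basic K"
    using basic_remove_exchange[OF M f p(1) nz[OF p(1)] p(2) q(1) nz[OF q(1)]] basic_subset
    by blast
qed

section \<open>The star\<close>

text \<open>The cycle visits the diagonal points in the order \<open>3, 2, 5, 4, \<dots>, 2 * m + 1, 2 * m\<close>. The first
  two families of points of value \<open>-1\<close> are the two parallel edges between \<open>2 * i + 2\<close> and
  \<open>2 * i + 3\<close>; the last family leads from \<open>2 * i + 2\<close> on to \<open>2 * i + 5\<close>.\<close>

definition open_star :: "nat \<Rightarrow> (nat \<times> nat \<times> nat) set" where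
  "open_star m = (\<lambda>j. (j, j, j)) ` {1..2 * m + 1}
     \<union> (\<lambda>i. (1, 2 * i + 2, 2 * i + 3)) ` {..<m}
     \<union> (\<lambda>i. (2 * i + 3, 1, 2 * i + 2)) ` {..<m}
     \<union> (\<lambda>i. (2 * i + 2, 2 * i + 5, 1)) ` {..<m - 1}"

text \<open>The added point is the edge from \<open>2 * m\<close> back to \<open>3\<close>, which closes the cycle.\<close>

definition star :: "nat \<Rightarrow> (nat \<times> nat \<times> nat) set" where
  "star m = insert (2 * m, 3, 1) (open_star m)"

definition star_weight :: "nat \<Rightarrow> nat \<times> nat \<times> nat \<Rightarrow> int" where
  "star_weight m = (\<lambda>(x, y, z). if x = y \<and> y = z then (if x = 1 then int m else 1) else -1)"

lemma star_subset_cube: "m > 0 \<Longrightarrow> star m \<subseteq> cube (2 * m + 1)"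
  by (auto simp: star_def open_star_def cube_def)

lemma star_minus_closing_point: "m > 0 \<Longrightarrow> star m - {(2 * m, 3, 1)} = open_star m"
  by (auto simp: star_def open_star_def)

text \<open>The normalisation \<open>b 1 = c 1 = 0\<close> and \<open>c (2 * i + 3) = 0\<close> costs nothing. The prescribed values
  at the diagonal points and at the two parallel edges then express all other unknowns by
  \<open>t i = b (2 * i + 3)\<close>. The remaining equation, at \<open>(2 * i + 2, 2 * i + 5, 1)\<close>, prescribes the
  increment \<open>t (i + 1) - t i\<close>; since the path is open, these increments can be summed up without
  any consistency condition.\<close>

lemma basic_open_star: "basic (open_star m)"
  unfolding basic_iff
proof
  fix g :: "nat \<times> nat \<times> nat \<Rightarrow> real"
  define A where "A i = g (1, 2 * i + 2, 2 * i + 3)" for i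
  define B where "B i = g (2 * i + 3, 1, 2 * i + 2)" for i
  define C where "C i = g (2 * i + 2, 2 * i + 5, 1)" for i
  define D where "D j = g (j, j, j)" for j
  define e where "e i = D (2 * i + 2) - A i + D 1 - B i + D (2 * i + 3)" for i
  define t where "t k = (\<Sum>i<k. C i - e i)" for k
  \<comment> \<open>Both \<open>2 * i + 2\<close> and \<open>2 * i + 3\<close> have \<open>i = j div 2 - 1\<close>.\<close>
  define a where "a j = (if j = 1 then D 1 else let i = j div 2 - 1 in
     if even j then e i - t i else D j - t i)" for j
  define b where "b j = (if j = 1 then 0 else let i = j div 2 - 1 in
     if even j then A i - D 1 else t i)" for j
  define c where "c j = (if j = 1 then 0 else let i = j div 2 - 1 in
     if even j then B i - D (2 * i + 3) + t i else 0)" for j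
  have even_vals: "a (2 * i + 2) = e i - t i" "b (2 * i + 2) = A i - D 1"
    "c (2 * i + 2) = B i - D (2 * i + 3) + t i" for i
    by (simp_all add: a_def b_def c_def Let_def)
  have odd_vals: "a (2 * i + 3) = D (2 * i + 3) - t i" "b (2 * i + 3) = t i" "c (2 * i + 3) = 0" for i
    by (simp_all add: a_def b_def c_def Let_def)
  have one_vals: "a 1 = D 1" "b 1 = 0" "c 1 = 0"
    by (simp_all add: a_def b_def c_def)
  have diag: "g (j, j, j) = a j + b j + c j" if "j \<ge> 1" for j
  proof -
    consider "j = 1" | i where "j = 2 * i + 2" | i where "j = 2 * i + 3"
    proof -
      have "j = 1 \<or> (\<exists>i. j = 2 * i + 2) \<or> (\<exists>i. j = 2 * i + 3)"
        using \<open>j \<ge> 1\<close> by presburger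
      then show ?thesis
        using that by blast
    qed
    then show ?thesis
    proof cases
      case 1
      then show ?thesis
        using one_vals by (simp add: D_def)
    next
      case (2 i)
      have "D (2 * i + 2) = a (2 * i + 2) + b (2 * i + 2) + c (2 * i + 2)"
        unfolding even_vals e_def by simp
      then show ?thesis
        by (simp only: D_def 2)
    next
      case (3 i)
      have "D (2 * i + 3) = a (2 * i + 3) + b (2 * i + 3) + c (2 * i + 3)"
        unfolding odd_vals by simp
      then show ?thesis
        by (simp only: D_def 3)
    qed
  qed
  have edges1: "A i = a 1 + b (2 * i + 2) + c (2 * i + 3)" for i
    unfolding one_vals even_vals odd_vals by simp
  have edges2: "B i = a (2 * i + 3) + b 1 + c (2 * i + 2)" for i
    unfolding one_vals even_vals odd_vals by simp
  have edges3: "C i = a (2 * i + 2) + b (2 * i + 5) + c 1" for i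
  proof -
    have "b (2 * i + 5) = t (Suc i)"
      using odd_vals(2)[of "Suc i"] by (simp add: numeral_eq_Suc)
    then show ?thesis
      unfolding even_vals one_vals by (simp add: t_def)
  qed
  have "\<forall>(x, y, z) \<in> open_star m. g (x, y, z) = a x + b y + c z"
    using diag edges1[unfolded A_def] edges2[unfolded B_def] edges3[unfolded C_def]
    unfolding open_star_def by (simp add: ball_Un)
  then show "\<exists>a b c. \<forall>(x, y, z) \<in> open_star m. g (x, y, z) = a x + b y + c z"
    by blast
qed

text \<open>On a layer through \<open>(1, 1, 1)\<close> the value \<open>m\<close> cancels against \<open>m\<close> edges; any other layer
  contains one diagonal point and one edge.\<close>

lemma annihilation_function_star:
  assumes m: "m > 0"
  shows "annihilation_function (2 * m + 1) (star m) (star_weight m)"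
  unfolding annihilation_function_iff[OF star_subset_cube[OF m]]
proof
  let ?w = "star_weight m"
  fix j
  assume j: "j \<in> {1..2 * m + 1}"
  have two: "sum ?w S = 0" if "S = {(j, j, j), p}" "j \<noteq> 1" "?w p = -1" for S p
  proof -
    have "?w (j, j, j) = 1"
      using that by (simp add: star_weight_def)
    then show ?thesis
      using that by (cases "p = (j, j, j)") auto
  qed
  have many: "sum ?w S = 0"
    if "S = insert (1, 1, 1) (p ` {..<m})" "inj_on p {..<m}" "\<And>i. ?w (p i) = -1" for S p
  proof -
    have "?w (1, 1, 1) = int m"
      by (simp add: star_weight_def)
    moreover from this have "(1, 1, 1) \<notin> p ` {..<m}"
      using that(3) by force
    ultimately show ?thesis
      using that by (simp add: sum.reindex)
  qed
  consider "j = 1" | i where "j = 2 * i + 2" "i < m" | i where "j = 2 * i + 3" "i < m"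
  proof -
    have "j = 1 \<or> (\<exists>i<m. j = 2 * i + 2) \<or> (\<exists>i<m. j = 2 * i + 3)"
      using j unfolding atLeastAtMost_iff by presburger
    then show ?thesis
      using that by blast
  qed
  then show "sum ?w {x \<in> star m. fst x = j} = 0 \<and> sum ?w {x \<in> star m. fst (snd x) = j} = 0 \<and>
      sum ?w {x \<in> star m. snd (snd x) = j} = 0"
  proof cases
    case 1
    have L1: "{x \<in> star m. fst x = j} = insert (1, 1, 1) ((\<lambda>i. (1, 2 * i + 2, 2 * i + 3)) ` {..<m})"
      using m 1 by (auto simp: star_def open_star_def)
    have L2: "{x \<in> star m. fst (snd x) = j}
        = insert (1, 1, 1) ((\<lambda>i. (2 * i + 3, 1, 2 * i + 2)) ` {..<m})"
      using m 1 by (auto simp: star_def open_star_def)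
    have L3: "{x \<in> star m. snd (snd x) = j} = insert (1, 1, 1)
        ((\<lambda>i. (2 * i + 2, if Suc i = m then 3 else 2 * i + 5, 1)) ` {..<m})"
    proof -
      \<comment> \<open>The closing point is the edge of the third family with index \<open>m - 1\<close>.\<close>
      have "{..<m} = insert (m - 1) {..<m - 1}"
        using m by auto
      then have "(\<lambda>i. (2 * i + 2, if Suc i = m then 3 else 2 * i + 5, 1)) ` {..<m}
          = insert (2 * m, 3, 1) ((\<lambda>i. (2 * i + 2, 2 * i + 5, 1 :: nat)) ` {..<m - 1})"
        using m by (auto simp: image_iff)
      then show ?thesis
        using m 1 by (auto simp: star_def open_star_def)
    qed
    show ?thesis
      using many[OF L1] many[OF L2] many[OF L3] by (simp add: star_weight_def inj_on_def)
  next
    case (2 i)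
    have L1: "{x \<in> star m. fst x = j} = {(j, j, j), (2 * i + 2, if Suc i = m then 3 else 2 * i + 5, 1)}"
      using m 2 by (auto simp: star_def open_star_def; presburger)
    have L2: "{x \<in> star m. fst (snd x) = j} = {(j, j, j), (1, 2 * i + 2, 2 * i + 3)}"
      using m 2 by (auto simp: star_def open_star_def; presburger)
    have L3: "{x \<in> star m. snd (snd x) = j} = {(j, j, j), (2 * i + 3, 1, 2 * i + 2)}"
      using m 2 by (auto simp: star_def open_star_def; presburger)
    show ?thesis
      using two[OF L1] two[OF L2] two[OF L3] 2 by (simp add: star_weight_def)
  next
    case (3 i)
    have L1: "{x \<in> star m. fst x = j} = {(j, j, j), (2 * i + 3, 1, 2 * i + 2)}"
      using m 3 by (auto simp: star_def open_star_def; presburger)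
    have L2: "{x \<in> star m. fst (snd x) = j}
        = {(j, j, j), (if i = 0 then 2 * m else 2 * i, 2 * i + 3, 1)}"
    \<comment> \<open>The edge of the third family arriving at \<open>2 * i + 3\<close>; for \<open>i = 0\<close> it is the closing point.\<close>
    proof (cases i)
      case 0
      then show ?thesis
        using m 3 by (auto simp: star_def open_star_def; presburger)
    next
      case (Suc k)
      then have j: "j = 2 * k + 5"
        and i: "2 * i + 3 = 2 * k + 5" "(if i = 0 then 2 * m else 2 * i) = 2 * k + 2"
        using 3 by simp_all
      have "(2 * k + 2, 2 * k + 5, 1) \<in> star m"
        using 3 Suc unfolding star_def open_star_def by (intro insertI2 UnI2 image_eqI[of _ _ k]) auto
      moreover have "(2 * k + 5, 2 * k + 5, 2 * k + 5) \<in> star m"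
        using 3 Suc by (simp add: star_def open_star_def image_iff)
      moreover have "x \<in> {(j, j, j), (2 * k + 2, 2 * k + 5, 1)}"
        if "x \<in> star m" "fst (snd x) = 2 * k + 5" for x
        using that j by (auto simp: star_def open_star_def; presburger)
      ultimately have "{x \<in> star m. fst (snd x) = 2 * k + 5}
          = {(2 * k + 5, 2 * k + 5, 2 * k + 5), (2 * k + 2, 2 * k + 5, 1)}"
        unfolding j by auto
      then show ?thesis
        unfolding j i .
    qed
    have L3: "{x \<in> star m. snd (snd x) = j} = {(j, j, j), (1, 2 * i + 2, 2 * i + 3)}"
      using m 3 by (auto simp: star_def open_star_def; presburger)
    show ?thesis
      using two[OF L1] two[OF L2] two[OF L3] 3 by (simp add: star_weight_def)
  qed
qed

theorem theorem1p7:
  fixes m :: nat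
  assumes "m > 0"
  shows "\<exists>n > 0. \<exists>M \<subseteq> cube n. minimal_non_basic M \<and>
           (\<exists>f. irreducible_annihilation_function n M f \<and> (\<exists>x \<in> M. f x = int m))"
proof -
  let ?n = "2 * m + 1" and ?M = "star m" and ?f = "star_weight m" and ?p = "(2 * m, 3, 1)"
  have sub: "?M \<subseteq> cube ?n" and ann: "annihilation_function ?n ?M ?f"
    using assms by (rule star_subset_cube, rule annihilation_function_star)
  have p: "?p \<in> ?M"
    by (simp add: star_def)
  have "minimal_non_basic ?M"
  proof (rule minimal_non_basicI[OF sub ann _ p])
    show "?f x \<noteq> 0" for x
      using assms by (auto simp: star_weight_def split: prod.splits)
    show "basic (?M - {?p})"
      using assms by (simp only: star_minus_closing_point basic_open_star)
  qed
  moreover have "irreducible_annihilation_function ?n ?M ?f"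
  proof -
    have "?f ?p = -1"
      by (simp add: star_weight_def)
    then have "-1 \<in> ?f ` ?M"
      using p by (metis imageI)
    then have "Gcd (?f ` ?M) dvd -1"
      by (rule Gcd_dvd)
    then have "Gcd (?f ` ?M) = 1"
      by simp
    then show ?thesis
      using ann by (simp add: irreducible_annihilation_function_def)
  qed
  moreover have "(1, 1, 1) \<in> ?M" "?f (1, 1, 1) = int m"
    by (auto simp: star_def open_star_def star_weight_def)
  ultimately have "minimal_non_basic ?M \<and>
      (\<exists>f. irreducible_annihilation_function ?n ?M f \<and> (\<exists>x \<in> ?M. f x = int m))"
    by (intro conjI exI[of _ ?f] bexI[of _ "(1, 1, 1)"])
  then show ?thesis
    using sub by (intro exI[of _ ?n] exI[of _ ?M] conjI) simp_all
qed

end
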